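(* Let $\mu,\nu$ be probability distributions on $\mathcal S$, let $\pi\in\Pi$, and let $\pi^\star$ be an optimal policy under $\nu$, i.e. a maximizer of $J_\nu$ over $\Pi$. If $\operatorname{supp}d_\nu^{\pi^\star}\subseteq\operatorname{supp}d_\mu^\pi$, then $$J_\nu(\pi^\star)-J_\nu(\pi)\le\sqrt2\,\mathcal C_2(\pi^\star,\pi,\nu,\mu)\,R_{\mathrm{pol}}(\pi).$$ Moreover there is a constant $C_{\mathrm{stat}}<\infty$, depending only on the discounted resolvent and bounded model quantities (in particular not on $(\pi,V,\lambda)$), such that if in addition $G=G(\pi,V,\lambda)\le1$ for some $V,\lambda\in\mathbb R^{|\mathcal S|}$, then $$J_\nu(\pi^\star)-J_\nu(\pi)\le\sqrt2\,\mathcal C_2(\pi^\star,\pi,\nu,\mu)\,C_{\mathrm{stat}}\sqrt G.$$ Every covered exact KKT point is globally optimal under $\nu$: if $G(\pi,V,\lambda)=0$ and $\operatorname{supp}d_\nu^{\pi^\star}\subseteq\operatorname{supp}d_\mu^\pi$, then $J_\nu(\pi)=J_\nu(\pi^\star)$.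
   Context: $(\mathcal S,\mathcal A,P,r,\gamma)$ is a finite discounted MDP, $0<\gamma<1$, $|r(s,a)|\le R_{\max}$. Policies: $\pi\in\Pi=\prod_{s}\Delta(\mathcal A)\subset\mathbb R^{|\mathcal S||\mathcal A|}$. $P_\pi(s,s')=\sum_a\pi(a|s)P(s'|s,a)$, $r_\pi(s)=\sum_a\pi(a|s)r(s,a)$, $M_\pi=I-\gamma P_\pi$, $R(\pi,V)=M_\pi V-r_\pi$, $J_\pi(\pi,V)=D_\pi R(\pi,V)$. $V^\pi=M_\pi^{-1}r_\pi$, $J_\nu(\pi)=\nu^{\mathsf T}V^\pi$, $F_\mu(\pi)=-J_\mu(\pi)$. $N_\Pi(\pi)$ is the normal cone of $\Pi$ at $\pi$; $\nabla F_\mu(\pi)$ is the gradient with respect to the coordinates $\pi(a|s)$ (using the formulas $P_\pi(s,s')=\sum_a\pi(a|s)P(s'|s,a)$ and $r_\pi(s)=\sum_a\pi(a|s)r(s,a)$, which extend off $\Pi$). Policy stationarity residual: $R_{\mathrm{pol}}(\pi)=\operatorname{dist}(0,\nabla F_\mu(\pi)+N_\Pi(\pi))$. Squared KKT residual (with zero regularizer and cost vector $c=-\mu$): $G(\pi,V,\lambda)=\operatorname{dist}^2(0,N_\Pi(\pi)+J_\pi(\pi,V)^{\mathsf T}\lambda)+\|M_\pi^{\mathsf T}\lambda-\mu\|^2+\|R(\pi,V)\|^2$. Norms and distances are Euclidean. Normalized discounted occupancy: $d_\mu^\pi=(1-\gamma)M_\pi^{-\mathsf T}\mu$. Mismatch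 coefficient: $\mathcal C_2(\pi^\star,\pi,\nu,\mu)=\big\|d_\nu^{\pi^\star}/d_\mu^\pi\big\|_2$, the Euclidean norm of the entrywise ratio, with $0/0=0$ and value $+\infty$ when a numerator is positive and its denominator is zero. *)

theory Defs
  imports "HOL-Analysis.Analysis"
begin

definition prob_simplex :: "(real ^ 'n) set" where
  "prob_simplex = {x. (\<forall>i. 0 \<le> x $ i) \<and> (\<Sum>i\<in>UNIV. x $ i) = 1}"

definition supp :: "real ^ 'n \<Rightarrow> 'n set" where
  "supp x = {i. x $ i \<noteq> 0}"

text \<open>Normal cone of convex analysis; it is empty at points outside \<open>C\<close>.\<close>

definition normal_cone :: "'e :: real_inner set \<Rightarrow> 'e \<Rightarrow> 'e set" where
  "normal_cone C x = {g. x \<in> C \<and> (\<forall>y\<in>C. g \<bullet> (y - x) \<le> 0)}"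

definition grad :: "('e :: real_inner \<Rightarrow> real) \<Rightarrow> 'e \<Rightarrow> 'e" where
  "grad f x = (THE D. GDERIV f x :> D)"

text \<open>
  States and actions are the finite types \<open>'s\<close> and \<open>'a\<close>; \<open>P s a $ s'\<close> is \<open>P(s'|s,a)\<close>.
  A policy is a vector \<open>p :: real ^ 'a ^ 's\<close> with \<open>p $ s $ a\<close> standing for \<open>p(a|s)\<close>; the norm and
  inner product of this nested vector type are the Euclidean ones of the space of all
  state-action coordinates.  The functions of \<open>p\<close> below are defined on the whole space,
  since they are differentiated with respect to these coordinates.
\<close>

definition mdp :: "('s::finite \<Rightarrow> 'a::finite \<Rightarrow> real ^ 's) \<Rightarrow> ('s \<Rightarrow> 'a \<Rightarrow> real) \<Rightarrow> real \<Rightarrow> bool" where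
  "mdp P r Rmax \<longleftrightarrow> (\<forall>s a. P s a \<in> prob_simplex) \<and> (\<forall>s a. \<bar>r s a\<bar> \<le> Rmax)"

definition policies :: "(real ^ 'a::finite ^ 's::finite) set" where
  "policies = {p. \<forall>s. p $ s \<in> prob_simplex}"

definition P_pol :: "('s::finite \<Rightarrow> 'a::finite \<Rightarrow> real ^ 's) \<Rightarrow> real ^ 'a ^ 's \<Rightarrow> real ^ 's ^ 's" where
  "P_pol P p = (\<chi> s s'. \<Sum>a\<in>UNIV. p $ s $ a * P s a $ s')"

definition r_pol :: "('s::finite \<Rightarrow> 'a::finite \<Rightarrow> real) \<Rightarrow> real ^ 'a ^ 's \<Rightarrow> real ^ 's" where
  "r_pol r p = (\<chi> s. \<Sum>a\<in>UNIV. p $ s $ a * r s a)"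

definition M_pol ::
    "real \<Rightarrow> ('s::finite \<Rightarrow> 'a::finite \<Rightarrow> real ^ 's) \<Rightarrow> real ^ 'a ^ 's \<Rightarrow> real ^ 's ^ 's" where
  "M_pol \<gamma> P p = mat 1 - \<gamma> *\<^sub>R P_pol P p"

definition bellman_res ::
    "real \<Rightarrow> ('s::finite \<Rightarrow> 'a::finite \<Rightarrow> real ^ 's) \<Rightarrow> ('s \<Rightarrow> 'a \<Rightarrow> real)
      \<Rightarrow> real ^ 'a ^ 's \<Rightarrow> real ^ 's \<Rightarrow> real ^ 's" where
  "bellman_res \<gamma> P r p V = M_pol \<gamma> P p *v V - r_pol r p"

text \<open>The partial derivative of the Bellman residual in the policy, as a linear map.\<close>

definition bellman_jac ::
    "real \<Rightarrow> ('s::finite \<Rightarrow> 'a::finite \<Rightarrow> real ^ 's) \<Rightarrow> ('s \<Rightarrow> 'a \<Rightarrow> real)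
      \<Rightarrow> real ^ 'a ^ 's \<Rightarrow> real ^ 's \<Rightarrow> real ^ 'a ^ 's \<Rightarrow> real ^ 's" where
  "bellman_jac \<gamma> P r p V = frechet_derivative (\<lambda>q. bellman_res \<gamma> P r q V) (at p)"

definition value_fn ::
    "real \<Rightarrow> ('s::finite \<Rightarrow> 'a::finite \<Rightarrow> real ^ 's) \<Rightarrow> ('s \<Rightarrow> 'a \<Rightarrow> real)
      \<Rightarrow> real ^ 'a ^ 's \<Rightarrow> real ^ 's" where
  "value_fn \<gamma> P r p = matrix_inv (M_pol \<gamma> P p) *v r_pol r p"

definition J_ret ::
    "real \<Rightarrow> ('s::finite \<Rightarrow> 'a::finite \<Rightarrow> real ^ 's) \<Rightarrow> ('s \<Rightarrow> 'a \<Rightarrow> real)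
      \<Rightarrow> real ^ 's \<Rightarrow> real ^ 'a ^ 's \<Rightarrow> real" where
  "J_ret \<gamma> P r \<nu> p = \<nu> \<bullet> value_fn \<gamma> P r p"

definition F_obj ::
    "real \<Rightarrow> ('s::finite \<Rightarrow> 'a::finite \<Rightarrow> real ^ 's) \<Rightarrow> ('s \<Rightarrow> 'a \<Rightarrow> real)
      \<Rightarrow> real ^ 's \<Rightarrow> real ^ 'a ^ 's \<Rightarrow> real" where
  "F_obj \<gamma> P r \<mu> p = - J_ret \<gamma> P r \<mu> p"

definition optimal_policy ::
    "real \<Rightarrow> ('s::finite \<Rightarrow> 'a::finite \<Rightarrow> real ^ 's) \<Rightarrow> ('s \<Rightarrow> 'a \<Rightarrow> real)
      \<Rightarrow> real ^ 's \<Rightarrow> real ^ 'a ^ 's \<Rightarrow> bool" where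
  "optimal_policy \<gamma> P r \<nu> p \<longleftrightarrow> is_arg_max (J_ret \<gamma> P r \<nu>) (\<lambda>q. q \<in> policies) p"

text \<open>
  The residuals are only meant for \<open>p \<in> policies\<close>.  There the normal cone contains \<open>0\<close>, so the
  sets whose distance to \<open>0\<close> is taken are nonempty (\<open>infdist\<close> to the empty set would be \<open>0\<close>).
\<close>

definition R_stat ::
    "real \<Rightarrow> ('s::finite \<Rightarrow> 'a::finite \<Rightarrow> real ^ 's) \<Rightarrow> ('s \<Rightarrow> 'a \<Rightarrow> real)
      \<Rightarrow> real ^ 's \<Rightarrow> real ^ 'a ^ 's \<Rightarrow> real" where
  "R_stat \<gamma> P r \<mu> p =
     infdist 0 {grad (F_obj \<gamma> P r \<mu>) p + n | n. n \<in> normal_cone policies p}"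

definition G_kkt ::
    "real \<Rightarrow> ('s::finite \<Rightarrow> 'a::finite \<Rightarrow> real ^ 's) \<Rightarrow> ('s \<Rightarrow> 'a \<Rightarrow> real)
      \<Rightarrow> real ^ 's \<Rightarrow> real ^ 'a ^ 's \<Rightarrow> real ^ 's \<Rightarrow> real ^ 's \<Rightarrow> real" where
  "G_kkt \<gamma> P r \<mu> p V l =
     (infdist 0 {n + adjoint (bellman_jac \<gamma> P r p V) l | n. n \<in> normal_cone policies p})\<^sup>2
     + (norm (transpose (M_pol \<gamma> P p) *v l - \<mu>))\<^sup>2
     + (norm (bellman_res \<gamma> P r p V))\<^sup>2"

definition occupancy ::
    "real \<Rightarrow> ('s::finite \<Rightarrow> 'a::finite \<Rightarrow> real ^ 's) \<Rightarrow> real ^ 's \<Rightarrow> real ^ 'a ^ 's \<Rightarrow> real ^ 's" where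
  "occupancy \<gamma> P \<mu> p = (1 - \<gamma>) *\<^sub>R (transpose (matrix_inv (M_pol \<gamma> P p)) *v \<mu>)"

text \<open>In the finite case the convention \<open>0/0 = 0\<close> is that of division on \<^typ>\<open>real\<close>.\<close>

definition ratio_norm :: "real ^ 'n \<Rightarrow> real ^ 'n \<Rightarrow> ereal" where
  "ratio_norm x y =
     (if \<exists>i. 0 < x $ i \<and> y $ i = 0 then \<infinity> else ereal (norm (\<chi> i. x $ i / y $ i)))"

definition mismatch ::
    "real \<Rightarrow> ('s::finite \<Rightarrow> 'a::finite \<Rightarrow> real ^ 's)
      \<Rightarrow> real ^ 'a ^ 's \<Rightarrow> real ^ 'a ^ 's \<Rightarrow> real ^ 's \<Rightarrow> real ^ 's \<Rightarrow> ereal" where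
  "mismatch \<gamma> P p' p \<nu> \<mu> = ratio_norm (occupancy \<gamma> P \<nu> p') (occupancy \<gamma> P \<mu> p)"

end

theory Submission
  imports Defs
begin

text \<open>
  With \<open>Q\<close> the state-action values of \<open>p\<close> and \<open>y = M_p\<^sup>-\<^sup>T \<mu>\<close>, the gradient of \<open>F_\<mu>\<close> at \<open>p\<close> has entries
  \<open>- y_s Q(s,a)\<close>. By the performance difference identity, the suboptimality of \<open>p\<close> under \<open>\<nu>\<close> equals
  \<open>\<Sum>\<^sub>s y'_s \<langle>p'_s - p_s, Q_s\<rangle>\<close> with \<open>y' = M_p'\<^sup>-\<^sup>T \<nu>\<close>, that is, minus the inner product of the gradient with
  the direction \<open>h_s = (y'_s / y_s) (p'_s - p_s)\<close>. Every normal vector at \<open>p\<close> has nonpositive inner product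
  with \<open>h\<close>, so the suboptimality is at most \<open>\<parallel>h\<parallel>\<close> times the stationarity residual, and \<open>\<parallel>h\<parallel>\<close> is at
  most \<open>\<surd>2\<close> times the norm of the ratio, as two points of a simplex have distance at most \<open>\<surd>2\<close>.
  The KKT term \<open>J_\<pi>\<^sup>T \<lambda>\<close> has entries \<open>- \<lambda>_s Q_V(s,a)\<close>; since \<open>\<lambda> - y\<close> and \<open>V - V\<^sup>p\<close> are resolvent images
  of the two other residuals, it differs from the gradient by \<open>O(\<surd>G)\<close>.
\<close>

section \<open>Estimates on the probability simplex\<close>

lemma simplex_inner_abs_le:
  fixes x v :: "real ^ 'n::finite"
  assumes "x \<in> prob_simplex" "\<And>i. \<bar>v $ i\<bar> \<le> c"
  shows "\<bar>x \<bullet> v\<bar> \<le> c"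
proof -
  have x: "0 \<le> x $ i" "(\<Sum>i\<in>UNIV. x $ i) = 1" for i
    using assms(1) by (auto simp: prob_simplex_def)
  have "\<bar>x \<bullet> v\<bar> \<le> (\<Sum>i\<in>UNIV. \<bar>x $ i * v $ i\<bar>)"
    by (simp add: inner_vec_def sum_abs)
  also have "\<dots> \<le> (\<Sum>i\<in>UNIV. x $ i * c)"
    by (intro sum_mono) (simp add: abs_mult x mult_left_mono assms(2))
  also have "\<dots> = c"
    by (simp add: x flip: sum_distrib_right)
  finally show ?thesis .
qed

lemma simplex_inner_ge:
  fixes x v :: "real ^ 'n::finite"
  assumes "x \<in> prob_simplex" "\<And>i. c \<le> v $ i"
  shows "c \<le> x \<bullet> v"
proof -
  have x: "0 \<le> x $ i" "(\<Sum>i\<in>UNIV. x $ i) = 1" for i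
    using assms(1) by (auto simp: prob_simplex_def)
  have "c = (\<Sum>i\<in>UNIV. x $ i * c)"
    by (simp add: x flip: sum_distrib_right)
  also have "\<dots> \<le> x \<bullet> v"
    by (simp add: inner_vec_def) (intro sum_mono mult_left_mono assms(2) x)
  finally show ?thesis .
qed

text \<open>In the expansion of the squared distance both squared norms are at most 1, and the cross
  term only helps because simplex points have nonnegative inner product.\<close>

lemma simplex_norm_diff_le:
  fixes x y :: "real ^ 'n::finite"
  assumes "x \<in> prob_simplex" "y \<in> prob_simplex"
  shows "norm (x - y) \<le> sqrt 2"
proof -
  have le1: "\<bar>z $ i\<bar> \<le> 1" if "z \<in> prob_simplex" for z :: "real ^ 'n" and i
    using that member_le_sum[of i UNIV "\<lambda>i. z $ i"] by (auto simp: prob_simplex_def)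
  have sq: "z \<bullet> z \<le> 1" if "z \<in> prob_simplex" for z :: "real ^ 'n"
    using simplex_inner_abs_le[OF that le1[OF that]] by simp
  have "0 \<le> x \<bullet> y"
    using assms(2) by (intro simplex_inner_ge[OF assms(1)]) (auto simp: prob_simplex_def)
  then have "(norm (x - y))\<^sup>2 \<le> 2"
    using sq[OF assms(1)] sq[OF assms(2)]
    by (simp add: power2_norm_eq_inner inner_diff_left inner_diff_right inner_commute)
  then show ?thesis
    by (rule real_le_rsqrt)
qed

section \<open>Gradients, distances from the origin, inverse matrices\<close>

lemma GDERIV_imp_grad_eq:
  assumes "GDERIV f x :> D"
  shows "grad f x = D"
  unfolding grad_def
proof (rule the_equality)
  fix E assume "GDERIV f x :> E"
  with assms have "(\<lambda>h. h \<bullet> E) = (\<lambda>h. h \<bullet> D)"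
    unfolding gderiv_def by (metis has_derivative_unique)
  then show "E = D"
    by (metis vector_eq_ldot)
qed (rule assms)

text \<open>Moving the base point of a translated set changes its distance from 0 by at most the
  displacement. This allows the gradient to be exchanged for the KKT term.\<close>

lemma infdist_zero_translate_le:
  fixes a b :: "'e :: real_normed_vector"
  assumes "N \<noteq> {}"
  shows "infdist 0 {a + n | n. n \<in> N} \<le> infdist 0 {b + n | n. n \<in> N} + norm (a - b)"
proof -
  have "infdist 0 {a + n | n. n \<in> N} - norm (a - b) \<le> infdist 0 {b + n | n. n \<in> N}"
  proof (subst infdist_notempty[of "{b + n | n. n \<in> N}"])
    show "{b + n | n. n \<in> N} \<noteq> {}" using assms by auto
    show "infdist 0 {a + n | n. n \<in> N} - norm (a - b) \<le> (INF x\<in>{b + n | n. n \<in> N}. dist 0 x)"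
    proof (rule cINF_greatest)
      show "{b + n | n. n \<in> N} \<noteq> {}" using assms by auto
      fix x assume "x \<in> {b + n | n. n \<in> N}"
      then obtain n where n: "n \<in> N" "x = b + n" by auto
      have "infdist 0 {a + n | n. n \<in> N} \<le> norm (a + n)"
        using n infdist_le[of "a + n" "{a + n | n. n \<in> N}" 0] by auto
      also have "\<dots> \<le> norm (b + n) + norm (a - b)"
        using norm_triangle_ineq[of "b + n" "a - b"] by (simp add: add.commute)
      finally show "infdist 0 {a + n | n. n \<in> N} - norm (a - b) \<le> dist 0 x"
        using n by simp
    qed
  qed
  then show ?thesis by simp
qed

text \<open>Passing to the infimum avoids choosing a nearest point of \<open>A\<close>.\<close>

lemma le_mult_infdist_zero:
  fixes A :: "'e :: real_normed_vector set"
  assumes "A \<noteq> {}" "0 \<le> D" "\<And>x. x \<in> A \<Longrightarrow> c \<le> D * norm x"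
  shows "c \<le> D * infdist 0 A"
proof (cases "D = 0")
  case True
  then show ?thesis using assms by fastforce
next
  case False
  with assms have "0 < D" by simp
  have "c / D \<le> infdist 0 A"
    unfolding infdist_notempty[OF assms(1)]
    using assms(3) \<open>0 < D\<close> by (intro cINF_greatest assms(1)) (simp add: field_simps)
  then show ?thesis using \<open>0 < D\<close> by (simp add: field_simps)
qed

lemma matrix_inv_inverse:
  assumes "invertible A"
  shows "A ** matrix_inv A = mat 1" "matrix_inv A ** A = mat 1"
  using someI_ex[OF assms[unfolded invertible_def]] unfolding matrix_inv_def by auto

text \<open>Common form of the gradient, the KKT term and the test direction: a state-action array
  whose rows carry state weights.\<close>

definition row_scale :: "real ^ 's \<Rightarrow> real ^ 'a ^ 's \<Rightarrow> real ^ 'a::finite ^ 's::finite" where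
  "row_scale y q = (\<chi> s. y $ s *\<^sub>R q $ s)"

lemma row_scale_nth [simp]: "row_scale y q $ s = y $ s *\<^sub>R q $ s"
  by (simp add: row_scale_def)

text \<open>For fixed \<open>q\<close>, this says that \<open>row_scale\<close> is adjoint to taking
  rowwise inner products with \<open>q\<close>.\<close>

lemma inner_row_scale: "h \<bullet> row_scale y q = y \<bullet> (\<chi> s. h $ s \<bullet> q $ s)"
  by (simp add: inner_vec_def[of h] inner_vec_def[of y])

text \<open>Error of the KKT term against the gradient per unit of residual. \<open>S * A\<close>
  counts the entries; the first product bounds the multiplier error times the size of
  \<open>q_val V\<close>, the second the size of \<open>weight\<close> times the error of
  \<open>q_val V\<close>.\<close>

definition stat_bound :: "real \<Rightarrow> real \<Rightarrow> nat \<Rightarrow> nat \<Rightarrow> real" where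
  "stat_bound \<gamma> Rmax S A = S * A *
     (S / (1 - \<gamma>) * (Rmax + (Rmax + 1) / (1 - \<gamma>)) + 1 / (1 - \<gamma>) * (1 / (1 - \<gamma>)))"

section \<open>The discounted Bellman operator and its resolvent\<close>

locale discounted_mdp =
  fixes \<gamma> Rmax :: real
    and P :: "'s::finite \<Rightarrow> 'a::finite \<Rightarrow> real ^ 's"
    and r :: "'s \<Rightarrow> 'a \<Rightarrow> real"
  assumes \<gamma>_pos: "0 < \<gamma>" and \<gamma>_less_1: "\<gamma> < 1"
    and mdp: "mdp P r Rmax"
begin

lemma P_simplex: "P s a \<in> prob_simplex" and r_bound: "\<bar>r s a\<bar> \<le> Rmax"
  using mdp by (auto simp: mdp_def)

text \<open>Taken at an arbitrary \<open>V\<close>, since a KKT point carries its own value vector;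
  at \<open>val p\<close> these are the state-action values of \<open>p\<close>.\<close>

definition q_val :: "real ^ 's \<Rightarrow> real ^ 'a ^ 's" where
  "q_val V = (\<chi> s a. r s a + \<gamma> * (P s a \<bullet> V))"

abbreviation "M \<equiv> M_pol \<gamma> P"
abbreviation "val \<equiv> value_fn \<gamma> P r"

text \<open>The occupancy without its normalizing factor \<open>1 - \<gamma>\<close>, which cancels
  in the mismatch ratio.\<close>

definition weight :: "real ^ 's \<Rightarrow> real ^ 'a ^ 's \<Rightarrow> real ^ 's" where
  "weight \<mu> p = transpose (matrix_inv (M p)) *v \<mu>"

lemma M_mult_nth: "(M p *v v) $ s = v $ s - \<gamma> * (\<Sum>a\<in>UNIV. p $ s $ a * (P s a \<bullet> v))"
proof -
  have "(P_pol P p *v v) $ s = (\<Sum>a\<in>UNIV. p $ s $ a * (P s a \<bullet> v))"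
    by (simp add: P_pol_def matrix_vector_mult_def inner_vec_def sum_distrib_left
        sum_distrib_right mult.assoc) (rule sum.swap)
  moreover have "M p *v v = v - \<gamma> *\<^sub>R (P_pol P p *v v)"
    by (simp add: M_pol_def matrix_vector_mult_diff_rdistrib scaleR_matrix_vector_assoc)
  ultimately show ?thesis by simp
qed

text \<open>In this form the residual is visibly affine in the policy: for the same
  \<open>V\<close>, two residuals differ by rowwise inner products of the policy difference with
  \<open>q_val V\<close>.\<close>

lemma bellman_res_eq: "bellman_res \<gamma> P r p V = V - (\<chi> s. p $ s \<bullet> q_val V $ s)"
  by (simp add: bellman_res_def vec_eq_iff M_mult_nth r_pol_def q_val_def inner_vec_def[of "p $ _"]
      sum.distrib distrib_left sum_distrib_left mult.left_commute)

text \<open>At a state where the modulus of \<open>v\<close> is maximal, the discounted term is at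
  most \<open>\<kappa>\<close> times that maximum. A general \<open>\<kappa>\<close> and absolute
  row sums cover points near a policy that are not policies themselves.\<close>

lemma M_mult_lower_bound:
  assumes row: "\<And>s. \<gamma> * (\<Sum>a\<in>UNIV. \<bar>p $ s $ a\<bar>) \<le> \<kappa>" and "\<kappa> < 1"
    and c: "\<And>s. \<bar>(M p *v v) $ s\<bar> \<le> c"
  shows "\<bar>v $ s\<bar> \<le> c / (1 - \<kappa>)"
proof -
  obtain m where m: "\<And>s. \<bar>v $ s\<bar> \<le> \<bar>v $ m\<bar>"
  proof -
    have "Max (range (\<lambda>s. \<bar>v $ s\<bar>)) \<in> range (\<lambda>s. \<bar>v $ s\<bar>)" by (intro Max_in) auto
    then obtain m where "Max (range (\<lambda>s. \<bar>v $ s\<bar>)) = \<bar>v $ m\<bar>" by (rule rangeE)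
    then show ?thesis
      using that[of m] Max_ge[of "range (\<lambda>s. \<bar>v $ s\<bar>)"] by (metis finite finite_imageI rangeI)
  qed
  have "\<bar>\<Sum>a\<in>UNIV. p $ m $ a * (P m a \<bullet> v)\<bar> \<le> (\<Sum>a\<in>UNIV. \<bar>p $ m $ a\<bar> * \<bar>v $ m\<bar>)"
    using simplex_inner_abs_le[OF P_simplex m]
    by (intro order_trans[OF sum_abs] sum_mono) (simp add: abs_mult mult_left_mono)
  then have "\<gamma> * \<bar>\<Sum>a\<in>UNIV. p $ m $ a * (P m a \<bullet> v)\<bar>
      \<le> \<gamma> * (\<Sum>a\<in>UNIV. \<bar>p $ m $ a\<bar>) * \<bar>v $ m\<bar>"
    using \<gamma>_pos by (simp add: sum_distrib_right)
  also have "\<dots> \<le> \<kappa> * \<bar>v $ m\<bar>"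
    by (intro mult_right_mono row) simp
  finally have "\<bar>\<gamma> * (\<Sum>a\<in>UNIV. p $ m $ a * (P m a \<bullet> v))\<bar> \<le> \<kappa> * \<bar>v $ m\<bar>"
    using \<gamma>_pos by (simp add: abs_mult)
  then have "\<bar>v $ m\<bar> \<le> c + \<kappa> * \<bar>v $ m\<bar>"
    using c[of m] by (simp add: M_mult_nth)
  then have "\<bar>v $ m\<bar> \<le> c / (1 - \<kappa>)"
    using \<open>\<kappa> < 1\<close> by (simp add: field_simps)
  then show ?thesis using m[of s] by linarith
qed

lemma invertible_M:
  assumes row: "\<And>s. \<gamma> * (\<Sum>a\<in>UNIV. \<bar>p $ s $ a\<bar>) \<le> \<kappa>" and "\<kappa> < 1"
  shows "invertible (M p)"
  unfolding invertible_left_inverse matrix_left_invertible_ker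
proof (intro allI impI)
  fix v assume "M p *v v = 0"
  then show "v = 0"
    using M_mult_lower_bound[OF assms, where c = 0 and v = v] by (simp add: vec_eq_iff)
qed

lemma policies_row_bound:
  assumes "p \<in> policies"
  shows "\<gamma> * (\<Sum>a\<in>UNIV. \<bar>p $ s $ a\<bar>) \<le> \<gamma>"
  using assms \<gamma>_pos by (simp add: policies_def prob_simplex_def)

lemmas invertible_M_policy = invertible_M[OF policies_row_bound \<gamma>_less_1]
lemmas M_mult_lower_bound_policy = M_mult_lower_bound[OF policies_row_bound \<gamma>_less_1]

lemma matrix_inv_M:
  assumes "invertible (M p)"
  shows "M p *v (matrix_inv (M p) *v v) = v" "matrix_inv (M p) *v (M p *v v) = v"
  using matrix_inv_inverse[OF assms] by (simp_all add: matrix_vector_mul_assoc)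

lemma weight_inner:
  assumes "invertible (M p)"
  shows "weight \<mu> p \<bullet> (M p *v v) = \<mu> \<bullet> v"
  by (simp add: weight_def dot_lmul_matrix matrix_inv_M assms)

lemma M_mult_val: "invertible (M p) \<Longrightarrow> M p *v val p = r_pol r p"
  by (simp add: value_fn_def matrix_inv_M)

lemma bellman_res_val: "invertible (M p) \<Longrightarrow> bellman_res \<gamma> P r p (val p) = 0"
  by (simp add: bellman_res_def M_mult_val)

lemma bellman_res_eq_M_diff:
  "invertible (M p) \<Longrightarrow> bellman_res \<gamma> P r p V = M p *v (V - val p)"
  by (simp add: bellman_res_def M_mult_val matrix_vector_mult_diff_distrib)

text \<open>Minimum principle: at a state minimizing \<open>v\<close>, the averaged successor value
  is no smaller than \<open>v\<close> there, so \<open>1 - \<gamma>\<close> times the minimum is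
  nonnegative.\<close>

lemma M_mult_nonneg:
  assumes "p \<in> policies" "\<And>s. 0 \<le> (M p *v v) $ s"
  shows "0 \<le> v $ s"
proof -
  obtain m where m: "\<And>s. v $ m \<le> v $ s"
  proof -
    have "Min (range (\<lambda>s. v $ s)) \<in> range (\<lambda>s. v $ s)" by (intro Min_in) auto
    then obtain m where "Min (range (\<lambda>s. v $ s)) = v $ m" by (rule rangeE)
    then show ?thesis
      using that[of m] Min_le[of "range (\<lambda>s. v $ s)"] by (metis finite finite_imageI rangeI)
  qed
  have p: "p $ m \<in> prob_simplex" using assms(1) by (simp add: policies_def)
  have "v $ m \<le> p $ m \<bullet> (\<chi> a. P m a \<bullet> v)"
    by (intro simplex_inner_ge[OF p]) (simp add: simplex_inner_ge[OF P_simplex m])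
  then have "\<gamma> * v $ m \<le> \<gamma> * (\<Sum>a\<in>UNIV. p $ m $ a * (P m a \<bullet> v))"
    using \<gamma>_pos by (simp add: inner_vec_def[of "p $ m"])
  with assms(2)[of m] have "0 \<le> (1 - \<gamma>) * v $ m"
    by (simp add: M_mult_nth algebra_simps)
  then show ?thesis
    using \<gamma>_less_1 m[of s] by (simp add: zero_le_mult_iff)
qed

text \<open>Reads a component off the transposed system through a column of the resolvent, so bounds
  for \<open>M p\<close> also serve its transpose.\<close>

lemma nth_eq_inner_inv:
  assumes "invertible (M p)"
  shows "z $ s = (transpose (M p) *v z) \<bullet> (matrix_inv (M p) *v axis s 1)"
  by (simp add: dot_lmul_matrix matrix_inv_M assms inner_axis)

lemma weight_nth: "weight \<mu> p $ s = \<mu> \<bullet> (matrix_inv (M p) *v axis s 1)"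
  unfolding weight_def by (metis dot_lmul_matrix transpose_matrix_vector cart_eq_inner_axis)

lemma transpose_M_weight:
  assumes "invertible (M p)"
  shows "transpose (M p) *v weight \<mu> p = \<mu>"
proof -
  have "(transpose (M p) *v weight \<mu> p) \<bullet> v = \<mu> \<bullet> v" for v
    using weight_inner[OF assms] by (simp add: dot_lmul_matrix)
  then show ?thesis by (metis vector_eq_rdot)
qed

section \<open>Resolvent bounds and continuity of the value at a policy\<close>

context
  fixes p :: "real ^ 'a ^ 's" assumes p: "p \<in> policies"
begin

text \<open>\<open>M p\<close> sends each column to a unit vector, whose entries lie between 0 and
  1; the minimum principle and the maximum bound apply.\<close>

lemma resolvent_bounds:
  shows "0 \<le> (matrix_inv (M p) *v axis s 1) $ t"
    and "\<bar>(matrix_inv (M p) *v axis s 1) $ t\<bar> \<le> 1 / (1 - \<gamma>)"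
proof -
  note inv = matrix_inv_M[OF invertible_M_policy[OF p]]
  show "0 \<le> (matrix_inv (M p) *v axis s 1) $ t"
    by (rule M_mult_nonneg[OF p]) (simp add: inv axis_def)
  show "\<bar>(matrix_inv (M p) *v axis s 1) $ t\<bar> \<le> 1 / (1 - \<gamma>)"
    by (rule M_mult_lower_bound_policy[OF p]) (simp add: inv axis_def)
qed

lemma weight_bounds:
  assumes "\<mu> \<in> prob_simplex"
  shows "0 \<le> weight \<mu> p $ s" and "\<bar>weight \<mu> p $ s\<bar> \<le> 1 / (1 - \<gamma>)"
  unfolding weight_nth
  using simplex_inner_ge[OF assms resolvent_bounds(1)]
    simplex_inner_abs_le[OF assms resolvent_bounds(2)] by auto

lemma transpose_M_lower_bound:
  "\<bar>z $ s\<bar> \<le> norm (transpose (M p) *v z) * (CARD('s) / (1 - \<gamma>))"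
proof -
  have "norm (matrix_inv (M p) *v axis s 1) \<le> (\<Sum>t\<in>(UNIV :: 's set). 1 / (1 - \<gamma>))"
    using resolvent_bounds(2) by (intro order_trans[OF norm_le_l1_cart] sum_mono)
  then have "norm (matrix_inv (M p) *v axis s 1) \<le> CARD('s) / (1 - \<gamma>)"
    by simp
  then have "norm (transpose (M p) *v z) * norm (matrix_inv (M p) *v axis s 1)
      \<le> norm (transpose (M p) *v z) * (CARD('s) / (1 - \<gamma>))"
    by (rule mult_left_mono) simp
  then show ?thesis
    unfolding nth_eq_inner_inv[OF invertible_M_policy[OF p], of z s]
    by (rule order_trans[OF Cauchy_Schwarz_ineq2])
qed

text \<open>Nearby \<open>q\<close> range over all coordinates, not only over policies. Applying
  \<open>M q\<close> to \<open>val q - val p\<close> gives minus the residual of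
  \<open>val p\<close> at \<open>q\<close>, which tends to its value 0 at \<open>p\<close>.\<close>

lemma val_tendsto: "(val \<longlongrightarrow> val p) (at p)"
  and eventually_invertible_M: "\<forall>\<^sub>F q in at p. invertible (M q)"
proof -
  have "((\<lambda>q. \<gamma> * (\<Sum>a\<in>UNIV. \<bar>q $ s $ a\<bar>)) \<longlongrightarrow> \<gamma> * (\<Sum>a\<in>UNIV. \<bar>p $ s $ a\<bar>)) (at p)" for s
    by (intro tendsto_intros)
  \<comment> \<open>The midpoint of \<open>\<gamma>\<close> and 1 leaves room on both sides: the row
    bound persists near \<open>p\<close> and stays below 1.\<close>
  moreover have "\<gamma> * (\<Sum>a\<in>UNIV. \<bar>p $ s $ a\<bar>) < (1 + \<gamma>) / 2" for s
    using policies_row_bound[OF p, of s] \<gamma>_less_1 by simp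
  ultimately have "\<forall>\<^sub>F q in at p. \<gamma> * (\<Sum>a\<in>UNIV. \<bar>q $ s $ a\<bar>) < (1 + \<gamma>) / 2" for s
    by (rule order_tendstoD(2))
  then have ev: "\<forall>\<^sub>F q in at p. \<forall>s. \<gamma> * (\<Sum>a\<in>UNIV. \<bar>q $ s $ a\<bar>) < (1 + \<gamma>) / 2"
    by (simp add: eventually_all_finite)
  have half: "(1 + \<gamma>) / 2 < 1" using \<gamma>_less_1 by simp
  show inv: "\<forall>\<^sub>F q in at p. invertible (M q)"
    using ev by eventually_elim (rule invertible_M[OF _ half], simp add: less_imp_le)
  show "(val \<longlongrightarrow> val p) (at p)"
  proof (rule vec_tendstoI)
    fix s
    let ?H = "\<lambda>q. norm (bellman_res \<gamma> P r q (val p)) / (1 - (1 + \<gamma>) / 2)"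
    have "(?H \<longlongrightarrow> norm (bellman_res \<gamma> P r p (val p)) / (1 - (1 + \<gamma>) / 2)) (at p)"
      unfolding bellman_res_eq using \<gamma>_less_1 by (intro tendsto_intros) auto
    then have "(?H \<longlongrightarrow> 0) (at p)"
      by (simp add: bellman_res_val invertible_M_policy[OF p])
    moreover have "\<forall>\<^sub>F q in at p. norm (val q $ s - val p $ s) \<le> ?H q"
      using ev inv
    proof eventually_elim
      case (elim q)
      have "\<bar>(val p - val q) $ s\<bar> \<le> ?H q"
        using elim half
        by (intro M_mult_lower_bound[of q])
          (auto simp: less_imp_le bellman_res_eq_M_diff intro: component_le_norm_cart)
      then show ?case by simp
    qed
    ultimately have "((\<lambda>q. val q $ s - val p $ s) \<longlongrightarrow> 0) (at p)"
      by (rule Lim_null_comparison[rotated])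
    then show "((\<lambda>q. val q $ s) \<longlongrightarrow> val p $ s) (at p)"
      by (simp add: LIM_zero_iff)
  qed
qed

section \<open>The policy gradient\<close>

text \<open>No inverse matrix is differentiated. The increment of the return is exactly
  \<open>q - p\<close> paired with the candidate gradient formed from \<open>val q\<close> instead
  of \<open>val p\<close>, so continuity of \<open>val\<close> at \<open>p\<close> suffices.\<close>

lemma GDERIV_J_ret: "GDERIV (J_ret \<gamma> P r \<mu>) p :> row_scale (weight \<mu> p) (q_val (val p))"
  unfolding gderiv_def has_derivative_iff_norm
proof (intro conjI)
  let ?g = "\<lambda>V. row_scale (weight \<mu> p) (q_val V)"
  show "bounded_linear (\<lambda>h. h \<bullet> ?g (val p))"
    by (rule bounded_linear_inner_left)
  have inv: "invertible (M p)" by (rule invertible_M_policy[OF p])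
  show "((\<lambda>q. norm (J_ret \<gamma> P r \<mu> q - J_ret \<gamma> P r \<mu> p - (q - p) \<bullet> ?g (val p)) / norm (q - p))
      \<longlongrightarrow> 0) (at p)"
  proof (rule Lim_null_comparison)
    have "((\<lambda>q. norm (?g (val q) - ?g (val p))) \<longlongrightarrow> norm (?g (val p) - ?g (val p))) (at p)"
      unfolding row_scale_def q_val_def by (intro tendsto_intros val_tendsto)
    then show "((\<lambda>q. norm (?g (val q) - ?g (val p))) \<longlongrightarrow> 0) (at p)"
      by simp
    show "\<forall>\<^sub>F q in at p. norm (norm (J_ret \<gamma> P r \<mu> q - J_ret \<gamma> P r \<mu> p - (q - p) \<bullet> ?g (val p))
        / norm (q - p)) \<le> norm (?g (val q) - ?g (val p))"
      using eventually_invertible_M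
    proof eventually_elim
      case (elim q)
      have "J_ret \<gamma> P r \<mu> q - J_ret \<gamma> P r \<mu> p = weight \<mu> p \<bullet> bellman_res \<gamma> P r p (val q)"
        by (simp add: J_ret_def bellman_res_eq_M_diff inv weight_inner inner_diff_right)
      \<comment> \<open>Subtracting the vanishing residual of \<open>val q\<close> at
        \<open>q\<close> leaves a change of policy at a fixed value vector.\<close>
      also have "\<dots> = weight \<mu> p \<bullet> (bellman_res \<gamma> P r p (val q) - bellman_res \<gamma> P r q (val q))"
        by (simp add: bellman_res_val elim)
      also have "bellman_res \<gamma> P r p (val q) - bellman_res \<gamma> P r q (val q)
          = (\<chi> s. (q - p) $ s \<bullet> q_val (val q) $ s)"
        by (simp add: bellman_res_eq vec_eq_iff inner_diff_left)
      also have "weight \<mu> p \<bullet> \<dots> = (q - p) \<bullet> ?g (val q)"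
        by (simp add: inner_row_scale)
      finally have "J_ret \<gamma> P r \<mu> q - J_ret \<gamma> P r \<mu> p - (q - p) \<bullet> ?g (val p)
          = (q - p) \<bullet> (?g (val q) - ?g (val p))"
        by (simp add: inner_diff_right)
      then have "norm (J_ret \<gamma> P r \<mu> q - J_ret \<gamma> P r \<mu> p - (q - p) \<bullet> ?g (val p))
          \<le> norm (q - p) * norm (?g (val q) - ?g (val p))"
        by (simp add: Cauchy_Schwarz_ineq2)
      then show ?case
        by (cases "q = p") (simp_all add: divide_le_eq mult.commute)
    qed
  qed
qed

lemma grad_F_obj: "grad (F_obj \<gamma> P r \<mu>) p = - row_scale (weight \<mu> p) (q_val (val p))"
  unfolding F_obj_def by (intro GDERIV_imp_grad_eq GDERIV_minus GDERIV_J_ret)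

section \<open>Normal vectors and the bound by the stationarity residual\<close>

lemma zero_in_normal_cone: "0 \<in> normal_cone policies p"
  using p by (simp add: normal_cone_def)

text \<open>
  A small positive multiple of the direction is feasible, because the rows of a policy may be moved
  independently towards those of \<open>q\<close>.
\<close>

lemma normal_cone_row_scale_le:
  assumes n: "n \<in> normal_cone policies p" and q: "q \<in> policies" and w: "\<And>s. 0 \<le> w $ s"
  shows "n \<bullet> row_scale w (q - p) \<le> 0"
proof -
  \<comment> \<open>With this step size every \<open>t * w $ s\<close> is at most 1, so each
    displaced row is a convex combination of the rows of \<open>p\<close> and
    \<open>q\<close>.\<close>
  define t where "t = 1 / (1 + (\<Sum>s\<in>UNIV. w $ s))"
  have sum: "0 \<le> (\<Sum>s\<in>UNIV. w $ s)" by (intro sum_nonneg w)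
  then have t: "0 < t" by (simp add: t_def)
  have tw: "t * w $ s \<le> 1" for s
    using member_le_sum[of s UNIV "\<lambda>s. w $ s"] w sum by (simp add: t_def divide_le_eq)
  have "p + t *\<^sub>R row_scale w (q - p) \<in> policies"
    unfolding policies_def mem_Collect_eq
  proof
    fix s
    have ps: "p $ s \<in> prob_simplex" "q $ s \<in> prob_simplex"
      using p q by (auto simp: policies_def)
    have eq: "(p + t *\<^sub>R row_scale w (q - p)) $ s
        = (1 - t * w $ s) *\<^sub>R p $ s + (t * w $ s) *\<^sub>R q $ s"
      by (simp add: algebra_simps)
    show "(p + t *\<^sub>R row_scale w (q - p)) $ s \<in> prob_simplex"
      using ps tw[of s] t w[of s] unfolding eq
      by (simp add: prob_simplex_def sum.distrib flip: sum_distrib_left)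
  qed
  with n have "n \<bullet> (p + t *\<^sub>R row_scale w (q - p) - p) \<le> 0"
    unfolding normal_cone_def by blast
  with t show ?thesis by (simp add: mult_le_0_iff)
qed

text \<open>\<open>weight \<nu> p'\<close> turns the value difference into minus the residual of
  \<open>val p\<close> at \<open>p'\<close>; the residual of \<open>val p\<close> at
  \<open>p\<close> is 0 and can be added.\<close>

lemma performance_difference:
  assumes p': "p' \<in> policies"
  shows "J_ret \<gamma> P r \<nu> p' - J_ret \<gamma> P r \<nu> p = (p' - p) \<bullet> row_scale (weight \<nu> p') (q_val (val p))"
proof -
  have inv: "invertible (M p)" "invertible (M p')"
    using p p' by (simp_all add: invertible_M_policy)
  have "bellman_res \<gamma> P r p (val p) - bellman_res \<gamma> P r p' (val p)
      = (\<chi> s. (p' - p) $ s \<bullet> q_val (val p) $ s)"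
    by (simp add: bellman_res_eq vec_eq_iff inner_diff_left)
  moreover have "J_ret \<gamma> P r \<nu> p' - J_ret \<gamma> P r \<nu> p
      = weight \<nu> p' \<bullet> (- bellman_res \<gamma> P r p' (val p))"
    by (simp add: J_ret_def bellman_res_eq_M_diff inv weight_inner inner_diff_right)
  ultimately show ?thesis
    by (simp add: inner_row_scale bellman_res_val inv)
qed

lemma suboptimality_le_R_stat:
  assumes p': "p' \<in> policies" and \<mu>: "\<mu> \<in> prob_simplex" and \<nu>: "\<nu> \<in> prob_simplex"
    and cover: "\<And>s. weight \<mu> p $ s = 0 \<Longrightarrow> weight \<nu> p' $ s = 0"
  shows "J_ret \<gamma> P r \<nu> p' - J_ret \<gamma> P r \<nu> p
    \<le> sqrt 2 * norm (\<chi> s. weight \<nu> p' $ s / weight \<mu> p $ s) * R_stat \<gamma> P r \<mu> p"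
  unfolding R_stat_def
proof (rule le_mult_infdist_zero)
  define w where "w = (\<chi> s. weight \<nu> p' $ s / weight \<mu> p $ s)"
  define h where "h = row_scale w (p' - p)"
  have w: "0 \<le> w $ s" for s
    using weight_bounds(1)[OF \<mu>] discounted_mdp.weight_bounds(1)[OF discounted_mdp_axioms p' \<nu>]
    by (simp add: w_def)
  have "norm h \<le> norm (sqrt 2 *\<^sub>R w)"
  proof (rule norm_le_componentwise_cart)
    fix s
    have "norm (p' $ s - p $ s) \<le> sqrt 2"
      using p p' by (intro simplex_norm_diff_le) (auto simp: policies_def)
    then show "norm (h $ s) \<le> norm ((sqrt 2 *\<^sub>R w) $ s)"
      using w[of s] by (simp add: h_def mult.commute mult_left_mono)
  qed
  then have h: "norm h \<le> sqrt 2 * norm w" by simp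
  have diff: "J_ret \<gamma> P r \<nu> p' - J_ret \<gamma> P r \<nu> p = - (grad (F_obj \<gamma> P r \<mu>) p \<bullet> h)"
  proof -
    \<comment> \<open>Where the denominator vanishes, division gives \<open>w $ s = 0\<close>, and
      \<open>cover\<close> makes the left side 0 as well.\<close>
    have "weight \<nu> p' $ s = w $ s * weight \<mu> p $ s" for s
      using cover by (simp add: w_def)
    then show ?thesis
      unfolding performance_difference[OF p'] grad_F_obj h_def
      by (simp add: inner_vec_def[of "_ :: real ^ 'a ^ 's"] inner_commute mult.assoc mult.left_commute sum_negf)
  qed
  show "{grad (F_obj \<gamma> P r \<mu>) p + n |n. n \<in> normal_cone policies p} \<noteq> {}"
    using zero_in_normal_cone by auto
  show "0 \<le> sqrt 2 * norm (\<chi> s. weight \<nu> p' $ s / weight \<mu> p $ s)" by simp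
  fix x assume "x \<in> {grad (F_obj \<gamma> P r \<mu>) p + n |n. n \<in> normal_cone policies p}"
  then obtain n where n: "n \<in> normal_cone policies p" "x = grad (F_obj \<gamma> P r \<mu>) p + n" by auto
  \<comment> \<open>The normal part of \<open>x\<close> has nonpositive inner product with
    \<open>h\<close>, so including it can only enlarge the right side.\<close>
  have "J_ret \<gamma> P r \<nu> p' - J_ret \<gamma> P r \<nu> p \<le> - (x \<bullet> h)"
    using normal_cone_row_scale_le[OF n(1) p' w] by (simp add: diff n(2) h_def inner_add_left)
  also have "\<dots> \<le> norm h * norm x"
    using norm_cauchy_schwarz[of "- x" h] by (simp add: mult.commute)
  also have "\<dots> \<le> sqrt 2 * norm w * norm x"
    by (intro mult_right_mono h) simp
  finally show "J_ret \<gamma> P r \<nu> p' - J_ret \<gamma> P r \<nu> p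
      \<le> sqrt 2 * norm (\<chi> s. weight \<nu> p' $ s / weight \<mu> p $ s) * norm x"
    by (simp add: w_def)
qed

section \<open>From the KKT residual to the stationarity residual\<close>

text \<open>The residual is affine in the policy, so its derivative is its linear part, whose
  adjoint is given by \<open>inner_row_scale\<close>.\<close>

lemma adjoint_bellman_jac: "adjoint (bellman_jac \<gamma> P r p V) l = - row_scale l (q_val V)"
proof -
  have "((\<lambda>q. bellman_res \<gamma> P r q V) has_derivative (\<lambda>h. - (\<chi> s. h $ s \<bullet> q_val V $ s))) (at p)"
  proof -
    have "bounded_linear (\<lambda>h :: real ^ 'a ^ 's. (\<chi> s. h $ s \<bullet> q_val V $ s))"
      by (intro linear_conv_bounded_linear[THEN iffD1] linearI)
        (simp_all add: vec_eq_iff inner_add_left)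
    then show ?thesis
      unfolding bellman_res_eq
      by (auto intro!: derivative_eq_intros bounded_linear_imp_has_derivative)
  qed
  then have "bellman_jac \<gamma> P r p V = (\<lambda>h. - (\<chi> s. h $ s \<bullet> q_val V $ s))"
    unfolding bellman_jac_def by (rule frechet_derivative_at[symmetric])
  moreover have "adjoint (\<lambda>h. - (\<chi> s. h $ s \<bullet> q_val V $ s)) = (\<lambda>l. - row_scale l (q_val V))"
    by (rule adjoint_unique) (simp add: inner_row_scale inner_commute)
  ultimately show ?thesis by simp
qed

lemma val_bound: "\<bar>val p $ s\<bar> \<le> Rmax / (1 - \<gamma>)"
proof (rule M_mult_lower_bound_policy[OF p])
  fix s
  have "r_pol r p $ s = p $ s \<bullet> (\<chi> a. r s a)"
    by (simp add: r_pol_def inner_vec_def)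
  moreover have "\<bar>p $ s \<bullet> (\<chi> a. r s a)\<bar> \<le> Rmax"
    using p by (intro simplex_inner_abs_le) (auto simp: policies_def r_bound)
  ultimately show "\<bar>(M p *v val p) $ s\<bar> \<le> Rmax"
    by (simp add: M_mult_val invertible_M_policy[OF p])
qed

lemma adjoint_jac_grad_dist:
  assumes \<mu>: "\<mu> \<in> prob_simplex"
    and \<delta>: "norm (transpose (M p) *v l - \<mu>) \<le> \<delta>" "norm (bellman_res \<gamma> P r p V) \<le> \<delta>" "\<delta> \<le> 1"
  shows "norm (grad (F_obj \<gamma> P r \<mu>) p - adjoint (bellman_jac \<gamma> P r p V) l) \<le> stat_bound \<gamma> Rmax CARD('s) CARD('a) * \<delta>"
proof -
  let ?y = "weight \<mu> p"
  note inv = invertible_M_policy[OF p]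
  have \<gamma>1: "0 < 1 - \<gamma>" using \<gamma>_less_1 by simp
  have \<delta>0: "0 \<le> \<delta>" using \<delta>(1) norm_ge_zero order_trans by blast
  have V: "\<bar>(V - val p) $ s\<bar> \<le> \<delta> / (1 - \<gamma>)" for s
    by (rule M_mult_lower_bound_policy[OF p])
      (use \<delta>(2) in \<open>simp add: bellman_res_eq_M_diff[OF inv] norm_bound_component_le_cart\<close>)
  have l: "\<bar>l $ s - ?y $ s\<bar> \<le> \<delta> * (CARD('s) / (1 - \<gamma>))" for s
  proof -
    have "transpose (M p) *v (l - ?y) = transpose (M p) *v l - \<mu>"
      by (simp only: matrix_vector_mult_diff_distrib transpose_M_weight[OF inv])
    then have "\<bar>(l - ?y) $ s\<bar> \<le> norm (transpose (M p) *v l - \<mu>) * (CARD('s) / (1 - \<gamma>))"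
      using transpose_M_lower_bound[of "l - ?y" s] by simp
    also have "\<dots> \<le> \<delta> * (CARD('s) / (1 - \<gamma>))"
      using \<gamma>1 by (intro mult_right_mono \<delta>(1)) simp
    finally show ?thesis by simp
  qed
  have qd: "\<bar>q_val V $ s $ a - q_val (val p) $ s $ a\<bar> \<le> \<delta> / (1 - \<gamma>)" for s a
  proof -
    have "\<bar>q_val V $ s $ a - q_val (val p) $ s $ a\<bar> = \<gamma> * \<bar>P s a \<bullet> (V - val p)\<bar>"
      using \<gamma>_pos by (simp add: q_val_def inner_diff_right abs_mult flip: right_diff_distrib)
    also have "\<dots> \<le> 1 * (\<delta> / (1 - \<gamma>))"
      using \<gamma>_pos \<gamma>_less_1 simplex_inner_abs_le[OF P_simplex V] by (intro mult_mono) auto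
    finally show ?thesis by simp
  qed
  have qb: "\<bar>q_val V $ s $ a\<bar> \<le> Rmax + (Rmax + 1) / (1 - \<gamma>)" for s a
  proof -
    \<comment> \<open>Here \<open>\<delta> \<le> 1\<close> enters: it keeps \<open>V\<close> within
      \<open>1 / (1 - \<gamma>)\<close> of \<open>val p\<close>, making the constant independent of
      \<open>V\<close>.\<close>
    have "\<bar>V $ t\<bar> \<le> (Rmax + 1) / (1 - \<gamma>)" for t
    proof -
      have "\<bar>V $ t\<bar> \<le> \<bar>(V - val p) $ t\<bar> + \<bar>val p $ t\<bar>" by simp
      also have "\<dots> \<le> 1 / (1 - \<gamma>) + Rmax / (1 - \<gamma>)"
        using \<gamma>1 \<delta>(3) by (intro add_mono val_bound order_trans[OF V divide_right_mono]) auto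
      finally show ?thesis by (simp add: add_divide_distrib)
    qed
    then have "\<gamma> * \<bar>P s a \<bullet> V\<bar> \<le> 1 * ((Rmax + 1) / (1 - \<gamma>))"
      using \<gamma>_pos \<gamma>_less_1 simplex_inner_abs_le[OF P_simplex] by (intro mult_mono) auto
    moreover have "\<bar>q_val V $ s $ a\<bar> \<le> \<bar>r s a\<bar> + \<gamma> * \<bar>P s a \<bullet> V\<bar>"
      using \<gamma>_pos abs_triangle_ineq[of "r s a" "\<gamma> * (P s a \<bullet> V)"] by (simp add: q_val_def abs_mult)
    ultimately show ?thesis using r_bound[of s a] by linarith
  qed
  let ?K = "CARD('s) / (1 - \<gamma>) * (Rmax + (Rmax + 1) / (1 - \<gamma>)) + 1 / (1 - \<gamma>) * (1 / (1 - \<gamma>))"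
  define D where "D = row_scale l (q_val V) - row_scale ?y (q_val (val p))"
  have entry: "\<bar>D $ s $ a\<bar> \<le> ?K * \<delta>" for s a
  proof -
    \<comment> \<open>Product splitting: each of the two errors meets a factor that is bounded
      uniformly.\<close>
    have "D $ s $ a = (l $ s - ?y $ s) * q_val V $ s $ a
        + ?y $ s * (q_val V $ s $ a - q_val (val p) $ s $ a)"
      by (simp add: D_def algebra_simps)
    then have "\<bar>D $ s $ a\<bar> \<le> \<bar>l $ s - ?y $ s\<bar> * \<bar>q_val V $ s $ a\<bar>
        + \<bar>?y $ s\<bar> * \<bar>q_val V $ s $ a - q_val (val p) $ s $ a\<bar>"
      by (metis abs_mult abs_triangle_ineq)
    also have "\<dots> \<le> (\<delta> * (CARD('s) / (1 - \<gamma>))) * (Rmax + (Rmax + 1) / (1 - \<gamma>))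
        + (1 / (1 - \<gamma>)) * (\<delta> / (1 - \<gamma>))"
      using \<gamma>1 \<delta>0 by (intro add_mono mult_mono l qb qd weight_bounds(2)[OF \<mu>]) auto
    also have "\<dots> = ?K * \<delta>"
    proof -
      have "\<delta> * x * y + z * (\<delta> / u) = (x * y + z * (1 / u)) * \<delta>" for x y z u :: real
        by (simp add: algebra_simps)
      then show ?thesis .
    qed
    finally show ?thesis .
  qed
  have "norm D \<le> (\<Sum>s\<in>UNIV. norm (D $ s))"
    by (simp add: norm_vec_def[of D] L2_set_le_sum)
  also have "\<dots> \<le> (\<Sum>s\<in>(UNIV :: 's set). \<Sum>a\<in>(UNIV :: 'a set). ?K * \<delta>)"
    by (intro sum_mono order_trans[OF norm_le_l1_cart] entry)
  also have "\<dots> = stat_bound \<gamma> Rmax CARD('s) CARD('a) * \<delta>"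
    by (simp add: stat_bound_def)
  finally show ?thesis
    by (simp add: adjoint_bellman_jac grad_F_obj D_def norm_minus_commute)
qed

text \<open>Each residual in \<open>G_kkt\<close> is at most its square root. The distance term
  gives the summand 1; the other two residuals control the exchange of the KKT term for the
  gradient.\<close>

lemma R_stat_le_G_kkt:
  assumes \<mu>: "\<mu> \<in> prob_simplex" and G: "G_kkt \<gamma> P r \<mu> p V l \<le> 1"
  shows "R_stat \<gamma> P r \<mu> p \<le> (1 + stat_bound \<gamma> Rmax CARD('s) CARD('a)) * sqrt (G_kkt \<gamma> P r \<mu> p V l)"
proof -
  define \<delta> where "\<delta> = sqrt (G_kkt \<gamma> P r \<mu> p V l)"
  let ?N = "normal_cone policies p"
  have "infdist 0 {n + adjoint (bellman_jac \<gamma> P r p V) l | n. n \<in> ?N} \<le> \<delta>"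
    and *: "norm (transpose (M p) *v l - \<mu>) \<le> \<delta>" "norm (bellman_res \<gamma> P r p V) \<le> \<delta>"
    unfolding \<delta>_def G_kkt_def by (intro real_le_rsqrt; simp)+
  then have inf: "infdist 0 {adjoint (bellman_jac \<gamma> P r p V) l + n | n. n \<in> ?N} \<le> \<delta>"
    by (subst add.commute)
  have "R_stat \<gamma> P r \<mu> p \<le> infdist 0 {adjoint (bellman_jac \<gamma> P r p V) l + n | n. n \<in> ?N}
      + norm (grad (F_obj \<gamma> P r \<mu>) p - adjoint (bellman_jac \<gamma> P r p V) l)"
    unfolding R_stat_def using zero_in_normal_cone by (intro infdist_zero_translate_le) auto
  also have "\<dots> \<le> \<delta> + stat_bound \<gamma> Rmax CARD('s) CARD('a) * \<delta>"
    using G by (intro add_mono inf adjoint_jac_grad_dist[OF \<mu> *]) (simp add: \<delta>_def)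
  finally show ?thesis by (simp add: \<delta>_def algebra_simps)
qed

section \<open>The mismatch coefficient under coverage, and the conclusion\<close>

text \<open>Coverage rules out the infinite branch of \<open>ratio_norm\<close>, and the factors
  \<open>1 - \<gamma>\<close> cancel.\<close>

lemma mismatch_eq:
  assumes p': "p' \<in> policies"
    and cover: "supp (occupancy \<gamma> P \<nu> p') \<subseteq> supp (occupancy \<gamma> P \<mu> p)"
  shows "weight \<mu> p $ s = 0 \<Longrightarrow> weight \<nu> p' $ s = 0"
    and "mismatch \<gamma> P p' p \<nu> \<mu> = ereal (norm (\<chi> s. weight \<nu> p' $ s / weight \<mu> p $ s))"
proof -
  have occ: "occupancy \<gamma> P \<mu> q $ s = (1 - \<gamma>) * weight \<mu> q $ s" for \<mu> q s
    by (simp add: occupancy_def weight_def)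
  have sup: "weight \<mu> p $ s = 0 \<Longrightarrow> weight \<nu> p' $ s = 0" for s
    using cover \<gamma>_less_1 unfolding supp_def occ by force
  then show "weight \<mu> p $ s = 0 \<Longrightarrow> weight \<nu> p' $ s = 0" .
  have "\<not> (\<exists>s. 0 < occupancy \<gamma> P \<nu> p' $ s \<and> occupancy \<gamma> P \<mu> p $ s = 0)"
    using \<gamma>_less_1 sup unfolding occ by force
  moreover have "occupancy \<gamma> P \<nu> p' $ s / occupancy \<gamma> P \<mu> p $ s
      = weight \<nu> p' $ s / weight \<mu> p $ s" for s
    using \<gamma>_less_1 by (simp add: occ)
  ultimately show "mismatch \<gamma> P p' p \<nu> \<mu> = ereal (norm (\<chi> s. weight \<nu> p' $ s / weight \<mu> p $ s))"
    by (simp only: mismatch_def ratio_norm_def if_False)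
qed

end

end

theorem theorem6p2:
  fixes \<gamma> Rmax :: real
  assumes "0 < \<gamma>" and "\<gamma> < 1"
  shows "\<exists>C_stat :: real.
    \<forall>(P :: 's::finite \<Rightarrow> 'a::finite \<Rightarrow> real ^ 's) (r :: 's \<Rightarrow> 'a \<Rightarrow> real)
      (\<mu> :: real ^ 's) (\<nu> :: real ^ 's) (\<pi> :: real ^ 'a ^ 's) (\<pi>' :: real ^ 'a ^ 's).
      mdp P r Rmax \<and> \<mu> \<in> prob_simplex \<and> \<nu> \<in> prob_simplex \<and> \<pi> \<in> policies
      \<and> optimal_policy \<gamma> P r \<nu> \<pi>'
      \<and> supp (occupancy \<gamma> P \<nu> \<pi>') \<subseteq> supp (occupancy \<gamma> P \<mu> \<pi>)
      \<longrightarrow>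
      ereal (J_ret \<gamma> P r \<nu> \<pi>' - J_ret \<gamma> P r \<nu> \<pi>)
        \<le> ereal (sqrt 2) * mismatch \<gamma> P \<pi>' \<pi> \<nu> \<mu> * ereal (R_stat \<gamma> P r \<mu> \<pi>)
      \<and> (\<forall>V l. G_kkt \<gamma> P r \<mu> \<pi> V l \<le> 1 \<longrightarrow>
           ereal (J_ret \<gamma> P r \<nu> \<pi>' - J_ret \<gamma> P r \<nu> \<pi>)
             \<le> ereal (sqrt 2) * mismatch \<gamma> P \<pi>' \<pi> \<nu> \<mu> * ereal (C_stat * sqrt (G_kkt \<gamma> P r \<mu> \<pi> V l)))
      \<and> (\<forall>V l. G_kkt \<gamma> P r \<mu> \<pi> V l = 0 \<longrightarrow> J_ret \<gamma> P r \<nu> \<pi> = J_ret \<gamma> P r \<nu> \<pi>')"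
\<comment> \<open>The witness involves only \<open>\<gamma>\<close>, \<open>Rmax\<close> and the
  numbers of states and actions.\<close>
proof (rule exI[of _ "1 + stat_bound \<gamma> Rmax CARD('s) CARD('a)"], intro allI impI, elim conjE)
  let ?K = "stat_bound \<gamma> Rmax CARD('s) CARD('a)"
  fix P :: "'s \<Rightarrow> 'a \<Rightarrow> real ^ 's" and r \<mu> \<nu> and \<pi> \<pi>' :: "real ^ 'a ^ 's"
  assume "mdp P r Rmax" and \<mu>: "\<mu> \<in> prob_simplex" and \<nu>: "\<nu> \<in> prob_simplex"
    and \<pi>: "\<pi> \<in> policies" and opt: "optimal_policy \<gamma> P r \<nu> \<pi>'"
    and cover: "supp (occupancy \<gamma> P \<nu> \<pi>') \<subseteq> supp (occupancy \<gamma> P \<mu> \<pi>)"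
  then interpret discounted_mdp \<gamma> Rmax P r
    using assms by unfold_locales
  let ?d = "J_ret \<gamma> P r \<nu> \<pi>' - J_ret \<gamma> P r \<nu> \<pi>"
  let ?C = "norm (\<chi> s. weight \<nu> \<pi>' $ s / weight \<mu> \<pi> $ s)"
  have \<pi>': "\<pi>' \<in> policies" and d0: "0 \<le> ?d"
    using opt \<pi> by (auto simp: optimal_policy_def is_arg_max_def not_less)
  note mis = mismatch_eq[OF \<pi> \<pi>' cover]
  have d: "?d \<le> sqrt 2 * ?C * R_stat \<gamma> P r \<mu> \<pi>"
    by (rule suboptimality_le_R_stat[OF \<pi> \<pi>' \<mu> \<nu> mis(1)])
  have dG: "?d \<le> sqrt 2 * ?C * ((1 + ?K) * sqrt (G_kkt \<gamma> P r \<mu> \<pi> V l))"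
    if "G_kkt \<gamma> P r \<mu> \<pi> V l \<le> 1" for V l
    using R_stat_le_G_kkt[OF \<pi> \<mu> that] by (intro order_trans[OF d] mult_left_mono) auto
  show "ereal ?d \<le> ereal (sqrt 2) * mismatch \<gamma> P \<pi>' \<pi> \<nu> \<mu> * ereal (R_stat \<gamma> P r \<mu> \<pi>)
      \<and> (\<forall>V l. G_kkt \<gamma> P r \<mu> \<pi> V l \<le> 1 \<longrightarrow>
           ereal ?d \<le> ereal (sqrt 2) * mismatch \<gamma> P \<pi>' \<pi> \<nu> \<mu>
             * ereal ((1 + ?K) * sqrt (G_kkt \<gamma> P r \<mu> \<pi> V l)))
      \<and> (\<forall>V l. G_kkt \<gamma> P r \<mu> \<pi> V l = 0 \<longrightarrow> J_ret \<gamma> P r \<nu> \<pi> = J_ret \<gamma> P r \<nu> \<pi>')"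
  proof (intro conjI allI impI)
    show "ereal ?d \<le> ereal (sqrt 2) * mismatch \<gamma> P \<pi>' \<pi> \<nu> \<mu> * ereal (R_stat \<gamma> P r \<mu> \<pi>)"
      using d by (simp add: mis(2))
    show "ereal ?d \<le> ereal (sqrt 2) * mismatch \<gamma> P \<pi>' \<pi> \<nu> \<mu>
        * ereal ((1 + ?K) * sqrt (G_kkt \<gamma> P r \<mu> \<pi> V l))" if "G_kkt \<gamma> P r \<mu> \<pi> V l \<le> 1" for V l
      using dG[OF that] by (simp add: mis(2))
    \<comment> \<open>The bound \<open>dG\<close> makes the gap nonpositive, and optimality of
      \<open>\<pi>'\<close> makes it nonnegative.\<close>
    show "J_ret \<gamma> P r \<nu> \<pi> = J_ret \<gamma> P r \<nu> \<pi>'" if "G_kkt \<gamma> P r \<mu> \<pi> V l = 0" for V l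
      using dG[of V l] d0 that by simp
  qed
qed

end
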